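(* Let $\Gamma$ be a strongly connected graph in which every node has at least one out-neighbour, and let $\mathbf{x}^*\in(0,\infty)^{\mathcal{V}(\Gamma)}$ satisfy $S^\Gamma_\land(\mathbf{x}^* )=m^\Gamma_\land$. Let $\mathfrak{A}=(B_1>\dots>B_k)$ be the preferential arrangement of $\mathbf{x}^*$-type, and let $\mathbf{y}^*\in(0,\infty)^k$ be defined by $y^*_{\alpha(v)}=x^*_v$ for $v\in\mathcal{V}(\Gamma)$. Then $\mathbf{y}^*$ is a minimizer of the function $\mathbf{y}\mapsto S^\Gamma_\land(\mathbf{y}\mid\mathfrak{A})$ on $(0,\infty)^k$, i.e. $S^\Gamma_\land(\mathbf{y}^*\mid\mathfrak{A})=\inf_{\mathbf{y}\in(0,\infty)^k}S^\Gamma_\land(\mathbf{y}\mid\mathfrak{A})$.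
   Context: A graph $\Gamma$ is a finite simple directed graph with node set $\mathcal{V}(\Gamma)$ and out-neighbour sets $\Gamma^+(v)\subseteq\mathcal{V}(\Gamma)$ (loops allowed, no multiple arcs); strongly connected means any two nodes are joined by directed paths in both directions. For $\mathbf{x}\in(0,\infty)^{\mathcal{V}(\Gamma)}$, $S^\Gamma_\land(\mathbf{x})=\sum_{v} x_v/\min_{w\in\Gamma^+(v)}x_w$, and $m^\Gamma_\land$ is the infimum of $S^\Gamma_\land$ (over nonzero nonnegative vectors with no term $0/0$, terms $a/0$, $a>0$, being $+\infty$). A preferential arrangement of a finite set is a partition into blocks together with a linear order $B_1>\dots>B_k$ of the blocks. For $\mathbf{x}\in(0,\infty)^{\mathcal{V}(\Gamma)}$, its $\mathbf{x}$-type arrangement is the unique preferential arrangement of $\mathcal{V}(\Gamma)$ such that $x_v=x_{v'}$ when $v,v'$ lie in the same block and $x_v>x_{v'}$ when $v\in B$, $v'\in B'$ with $B>B'$. For a preferential arrangement $\mathfrak{A}=(B_1>\dots>B_k)$ of $\mathcal{V}(\Gamma)$, define $\alpha,\beta:\mathcal{V}(\Gamma)\to\{1,\dots,k\}$ by $\alpha(v)=j$ if $v\in B_j$, and $\beta(v)=j$ where $B_j$ is the smallest (in the order of $\mathfrak{A}$, i.e. largest index $j$) block meeting $\Gamma^+(v)$. The $\mathfrak{A}$-reduction is $S^\Gamma_\land(\mathbf{y}\mid\mathfrak{A})=\sum_{v\in\mathcal{V}(\Gamma)} y_{\alpha(v)}/y_{\beta(v)}$ for $\mathbf{y}=(y_1,\dots,y_k)\in(0,\infty)^k$.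 *)

theory Defs
  imports
    "Graph_Theory.Digraph_Component"
    "HOL-Library.Disjoint_Sets"
    "HOL-Library.Extended_Nonnegative_Real"
begin

text \<open>
  A finite directed graph with loops allowed and no multiple arcs is a
  \<open>pair_pre_digraph\<close> satisfying the locale predicate \<open>pair_fin_digraph\<close>.
  Vectors indexed by a set are total functions of which only the values on that set are used.
\<close>

definition out_nbrs :: "'a pair_pre_digraph \<Rightarrow> 'a \<Rightarrow> 'a set" where
  "out_nbrs G v = {w. (v, w) \<in> parcs G}"

definition positive_on :: "'i set \<Rightarrow> ('i \<Rightarrow> real) set" where
  "positive_on I = {x. \<forall>i\<in>I. 0 < x i}"

definition min_out :: "'a pair_pre_digraph \<Rightarrow> ('a \<Rightarrow> real) \<Rightarrow> 'a \<Rightarrow> real" where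
  "min_out G x v = Min (x ` out_nbrs G v)"

definition S_min :: "'a pair_pre_digraph \<Rightarrow> ('a \<Rightarrow> real) \<Rightarrow> real" where
  "S_min G x = (\<Sum>v\<in>pverts G. x v / min_out G x v)"

text \<open>
  The extension of \<^const>\<open>S_min\<close> to nonnegative vectors. In \<^typ>\<open>ennreal\<close> a quotient \<open>a / 0\<close>
  with \<open>a > 0\<close> is \<open>\<infinity>\<close>, as required; the value \<open>0 / 0 = 0\<close> is never used, since such
  vectors are excluded from the infimum below.
\<close>

definition S_min_ext :: "'a pair_pre_digraph \<Rightarrow> ('a \<Rightarrow> real) \<Rightarrow> ennreal" where
  "S_min_ext G x = (\<Sum>v\<in>pverts G. ennreal (x v) / ennreal (min_out G x v))"

definition admissible :: "'a pair_pre_digraph \<Rightarrow> ('a \<Rightarrow> real) set" where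
  "admissible G = {x. (\<forall>v\<in>pverts G. 0 \<le> x v) \<and> (\<exists>v\<in>pverts G. x v \<noteq> 0) \<and>
     (\<forall>v\<in>pverts G. \<not> (x v = 0 \<and> min_out G x v = 0))}"

definition m_min :: "'a pair_pre_digraph \<Rightarrow> ennreal" where
  "m_min G = (INF x\<in>admissible G. S_min_ext G x)"

lemma ennreal_divide_0: "0 < a \<Longrightarrow> ennreal a / ennreal 0 = \<infinity>"
  by (simp add: ennreal_divide_eq_top_iff)

lemma S_min_ext_positive:
  assumes G: "pair_fin_digraph G"
    and out: "\<And>v. v \<in> pverts G \<Longrightarrow> out_nbrs G v \<noteq> {}"
    and x: "x \<in> positive_on (pverts G)"
  shows "S_min_ext G x = ennreal (S_min G x)"
proof -
  interpret pair_fin_digraph G by (fact G)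
  have pos: "0 < min_out G x v" if v: "v \<in> pverts G" for v
  proof -
    have sub: "out_nbrs G v \<subseteq> pverts G"
      by (auto simp: out_nbrs_def dest: in_arcsD2)
    then have "finite (out_nbrs G v)"
      using pair_finite_verts finite_subset by blast
    then have "Min (x ` out_nbrs G v) \<in> x ` out_nbrs G v"
      using out[OF v] by (intro Min_in) auto
    then show ?thesis
      using sub x by (auto simp: min_out_def positive_on_def)
  qed
  have xpos: "0 < x v" if "v \<in> pverts G" for v
    using x that by (simp add: positive_on_def)
  have "S_min_ext G x = (\<Sum>v\<in>pverts G. ennreal (x v / min_out G x v))"
    unfolding S_min_ext_def using pos xpos
    by (intro sum.cong) (auto simp: divide_ennreal less_imp_le)
  also have "\<dots> = ennreal (S_min G x)"
    unfolding S_min_def using pos xpos by (intro sum_ennreal) (simp add: less_imp_le)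
  finally show ?thesis .
qed

text \<open>
  A preferential arrangement \<open>B\<^sub>1 > \<dots> > B\<^sub>k\<close> is the list \<open>[B\<^sub>1, \<dots>, B\<^sub>k]\<close> of its blocks in
  decreasing order. Following the indexing of lists, block numbers range over \<open>{..<k}\<close>
  instead of \<open>{1..k}\<close>.
\<close>

definition preferential_arrangement :: "'a set \<Rightarrow> 'a set list \<Rightarrow> bool" where
  "preferential_arrangement V A \<longleftrightarrow> distinct A \<and> partition_on V (set A)"

definition arrangement_of_type :: "'a set \<Rightarrow> ('a \<Rightarrow> real) \<Rightarrow> 'a set list \<Rightarrow> bool" where
  "arrangement_of_type V x A \<longleftrightarrow> preferential_arrangement V A \<and>
     (\<forall>i<length A. \<forall>v\<in>A ! i. \<forall>v'\<in>A ! i. x v = x v') \<and>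
     (\<forall>i j. i < j \<and> j < length A \<longrightarrow> (\<forall>v\<in>A ! i. \<forall>v'\<in>A ! j. x v > x v'))"

definition block_index :: "'a set list \<Rightarrow> 'a \<Rightarrow> nat" where
  "block_index A v = (THE j. j < length A \<and> v \<in> A ! j)"

definition out_block_index :: "'a pair_pre_digraph \<Rightarrow> 'a set list \<Rightarrow> 'a \<Rightarrow> nat" where
  "out_block_index G A v = Max {j. j < length A \<and> A ! j \<inter> out_nbrs G v \<noteq> {}}"

definition S_min_reduction :: "'a pair_pre_digraph \<Rightarrow> 'a set list \<Rightarrow> (nat \<Rightarrow> real) \<Rightarrow> real" where
  "S_min_reduction G A y = (\<Sum>v\<in>pverts G. y (block_index A v) / y (out_block_index G A v))"

end

theory Submission
  imports Defs "HOL-Analysis.Convex"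
begin

text \<open>
  As long as \<open>z\<close> is ordered in the same way as the blocks, \<open>S_min_reduction G A z\<close> is the value of
  \<open>S_min G\<close> at the vector that is constantly \<open>z j\<close> on the \<open>j\<close>-th block, hence at least \<open>m_min G\<close>.
  The vector \<open>y\<close> is strictly ordered, so this applies to every vector close to \<open>y\<close> and \<open>y\<close> is a
  local minimizer of the reduction. The reduction is a sum of monomials and therefore convex along
  the geometric segments \<open>y\<^bsup>1 - t\<^esup> z\<^bsup>t\<^esup>\<close>, so a local minimizer is a global one.
\<close>

text \<open>Disjointness makes two blocks containing \<open>v\<close> the same set, and distinctness
  of the list then makes their positions equal. So the description by \<open>THE\<close>
  denotes.\<close>

lemma block_index_eq:
  assumes "preferential_arrangement V A" and "j < length A" and "v \<in> A ! j"
  shows "block_index A v = j"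
  unfolding block_index_def
proof (rule the_equality)
  fix i assume i: "i < length A \<and> v \<in> A ! i"
  then have "A ! i = A ! j"
    using assms unfolding preferential_arrangement_def partition_on_def disjoint_def
    by (meson disjoint_iff nth_mem)
  then show "i = j"
    using assms i by (simp add: preferential_arrangement_def nth_eq_iff_index_eq)
qed (use assms in simp)

lemma
  assumes "preferential_arrangement V A" and "v \<in> V"
  shows block_index_less: "block_index A v < length A"
    and mem_block_index: "v \<in> A ! block_index A v"
proof -
  have "v \<in> \<Union> (set A)"
    using assms by (simp add: preferential_arrangement_def partition_on_def)
  then obtain j where "j < length A" "v \<in> A ! j"
    by (auto simp: in_set_conv_nth)
  with block_index_eq[OF assms(1) this]
  show "block_index A v < length A" "v \<in> A ! block_index A v" by simp_all
qed

text \<open>Parts of a partition are nonempty, so every index has a representative node; through it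
  facts about a vector on nodes pass to the vector on block indices.\<close>

lemma ex_block_index:
  assumes "preferential_arrangement V A" and "j < length A"
  obtains v where "v \<in> V" "v \<in> A ! j" "block_index A v = j"
proof -
  have "A ! j \<in> set A" using assms(2) by simp
  then have "A ! j \<noteq> {}" "A ! j \<subseteq> V"
    using assms(1) by (auto simp: preferential_arrangement_def partition_on_def)
  then show thesis
    using that block_index_eq[OF assms] by blast
qed

text \<open>Brings the index into the shape of a maximum over an image, to which
  \<open>Min_image_antimono_on\<close> applies.\<close>

lemma out_block_index_eq:
  assumes "preferential_arrangement V A" and "out_nbrs G v \<subseteq> V"
  shows "out_block_index G A v = Max (block_index A ` out_nbrs G v)"
proof -
  have "{j. j < length A \<and> A ! j \<inter> out_nbrs G v \<noteq> {}} = block_index A ` out_nbrs G v"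
  proof (intro equalityI subsetI)
    fix j assume "j \<in> {j. j < length A \<and> A ! j \<inter> out_nbrs G v \<noteq> {}}"
    then obtain w where "j < length A" "w \<in> A ! j" "w \<in> out_nbrs G v" by blast
    then show "j \<in> block_index A ` out_nbrs G v"
      using block_index_eq[OF assms(1)] by (intro rev_image_eqI[of w]) auto
  next
    fix j assume "j \<in> block_index A ` out_nbrs G v"
    then obtain w where "w \<in> out_nbrs G v" "j = block_index A w" by blast
    then show "j \<in> {j. j < length A \<and> A ! j \<inter> out_nbrs G v \<noteq> {}}"
      using block_index_less[OF assms(1)] mem_block_index[OF assms(1)] assms(2) by blast
  qed
  then show ?thesis by (simp add: out_block_index_def)
qed

lemma Min_image_antimono_on:
  fixes f :: "'a::linorder \<Rightarrow> 'b::linorder"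
  assumes "antimono_on A f" and "finite A" and "A \<noteq> {}"
  shows "Min (f ` A) = f (Max A)"
proof (rule Min_eqI)
  fix b assume "b \<in> f ` A"
  then obtain a where "a \<in> A" "b = f a" by blast
  then show "f (Max A) \<le> b"
    using assms by (simp add: monotone_onD[OF assms(1)])
qed (use assms in auto)

context
  fixes G :: "'a pair_pre_digraph"
  assumes G: "pair_fin_digraph G"
    and out: "\<And>v. v \<in> pverts G \<Longrightarrow> out_nbrs G v \<noteq> {}"
begin

lemma out_nbrs_subset: "out_nbrs G v \<subseteq> pverts G"
proof -
  interpret pair_fin_digraph G by (fact G)
  show ?thesis by (auto simp: out_nbrs_def dest: in_arcsD2)
qed

lemma finite_pverts: "finite (pverts G)"
  using G by (simp add: pair_fin_digraph.pair_finite_verts)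

lemma finite_out_nbrs: "finite (out_nbrs G v)"
  using finite_subset[OF out_nbrs_subset finite_pverts] .

lemma out_block_index_mem:
  assumes "preferential_arrangement (pverts G) A" and "v \<in> pverts G"
  shows "out_block_index G A v \<in> block_index A ` out_nbrs G v"
  unfolding out_block_index_eq[OF assms(1) out_nbrs_subset]
  using out[OF assms(2)] finite_out_nbrs by (intro Max_in) auto

lemma out_block_index_less:
  assumes "preferential_arrangement (pverts G) A" and "v \<in> pverts G"
  shows "out_block_index G A v < length A"
proof -
  obtain w where "w \<in> out_nbrs G v" "out_block_index G A v = block_index A w"
    using out_block_index_mem[OF assms] by blast
  then show ?thesis
    using block_index_less[OF assms(1), of w] out_nbrs_subset[of v] by auto
qed

text \<open>Later blocks carry values that are no larger, so the minimum over the out-neighbours of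
  \<open>v\<close> is attained in the last block they meet. Ties between blocks do not change this
  minimum, hence weak monotonicity suffices.\<close>

lemma S_min_reduction_antimono:
  assumes A: "preferential_arrangement (pverts G) A"
    and z: "antimono_on {..<length A} z"
  shows "S_min_reduction G A z = S_min G (\<lambda>v. z (block_index A v))"
  unfolding S_min_reduction_def S_min_def
proof (rule sum.cong)
  fix v assume v: "v \<in> pverts G"
  have "min_out G (\<lambda>v. z (block_index A v)) v = Min (z ` block_index A ` out_nbrs G v)"
    by (simp add: min_out_def image_image)
  also have "\<dots> = z (out_block_index G A v)"
    unfolding out_block_index_eq[OF A out_nbrs_subset]
    using out[OF v] finite_out_nbrs block_index_less[OF A] out_nbrs_subset
    by (intro Min_image_antimono_on monotone_on_subset[OF z]) auto
  finally show "z (block_index A v) / z (out_block_index G A v) =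
      z (block_index A v) / min_out G (\<lambda>v. z (block_index A v)) v" by simp
qed simp

lemma m_min_le_S_min:
  assumes "pverts G \<noteq> {}" and x: "x \<in> positive_on (pverts G)"
  shows "m_min G \<le> ennreal (S_min G x)"
proof -
  \<comment> \<open>Positivity rules out terms 0/0, and any node supplies a nonzero entry.\<close>
  have "x \<in> admissible G"
    using assms by (fastforce simp: admissible_def positive_on_def)
  then have "m_min G \<le> S_min_ext G x"
    unfolding m_min_def by (rule INF_lower)
  then show ?thesis
    using S_min_ext_positive[OF G out x] by simp
qed

text \<open>A quotient of weighted geometric means is the weighted geometric mean of the quotients,
  so weighted AM-GM bounds each summand separately.\<close>

lemma S_min_reduction_geometric_mean:
  assumes A: "preferential_arrangement (pverts G) A"
    and y: "y \<in> positive_on {..<length A}" and z: "z \<in> positive_on {..<length A}"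
    and t: "0 \<le> t" "t \<le> 1"
  shows "S_min_reduction G A (\<lambda>j. y j powr (1 - t) * z j powr t) \<le>
    (1 - t) * S_min_reduction G A y + t * S_min_reduction G A z"
proof -
  have "S_min_reduction G A (\<lambda>j. y j powr (1 - t) * z j powr t) \<le>
    (\<Sum>v\<in>pverts G. (1 - t) * (y (block_index A v) / y (out_block_index G A v)) +
      t * (z (block_index A v) / z (out_block_index G A v)))"
    unfolding S_min_reduction_def
  proof (rule sum_mono)
    fix v assume v: "v \<in> pverts G"
    define a b where "a = block_index A v" and "b = out_block_index G A v"
    have pos: "0 < y a" "0 < y b" "0 < z a" "0 < z b"
      using y z block_index_less[OF A v] out_block_index_less[OF A v]
      by (auto simp: positive_on_def a_def b_def)
    have "(y a powr (1 - t) * z a powr t) / (y b powr (1 - t) * z b powr t) =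
        (y a / y b) powr (1 - t) * (z a / z b) powr t"
      using pos by (simp add: powr_divide)
    also have "\<dots> \<le> (1 - t) * (y a / y b) + t * (z a / z b)"
      using pos t by (intro Youngs_inequality_0) auto
    finally show "(y a powr (1 - t) * z a powr t) / (y b powr (1 - t) * z b powr t) \<le>
      (1 - t) * (y a / y b) + t * (z a / z b)" .
  qed
  then show ?thesis
    by (simp add: S_min_reduction_def sum.distrib sum_distrib_left)
qed

end

text \<open>The curve tends to \<open>y\<close> as \<open>t\<close> decreases to 0, and the strict
  order of \<open>y\<close> amounts to finitely many strict inequalities. Each of them survives for
  small \<open>t\<close>.\<close>

lemma eventually_antimono_on_geometric_mean:
  fixes y z :: "nat \<Rightarrow> real"
  assumes y: "strict_antimono_on {..<k} y" "y \<in> positive_on {..<k}"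
    and z: "z \<in> positive_on {..<k}"
  shows "\<forall>\<^sub>F t in at_right 0. antimono_on {..<k} (\<lambda>j. y j powr (1 - t) * z j powr t)"
proof -
  let ?u = "\<lambda>t j. y j powr (1 - t) * z j powr t"
  have lim: "((\<lambda>t. ?u t j) \<longlongrightarrow> y j) (at_right 0)" if "j < k" for j
  proof -
    have "0 < y j" "0 < z j" using y z that by (auto simp: positive_on_def)
    then have "((\<lambda>t. ?u t j) \<longlongrightarrow> y j powr (1 - 0) * z j powr 0) (at_right 0)"
      by (intro tendsto_intros) auto
    \<comment> \<open>Positivity matters here: \<open>powr\<close> has exponent-zero value 1 only
      for a nonzero base, as \<open>0 powr 0 = 0\<close>.\<close>
    then show ?thesis using \<open>0 < y j\<close> \<open>0 < z j\<close> by simp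
  qed
  have "\<forall>\<^sub>F t in at_right 0. \<forall>i\<in>{..<k}. \<forall>j\<in>{..<k}. i < j \<longrightarrow> ?u t j < ?u t i"
  proof (intro eventually_ball_finite ballI finite_lessThan)
    fix i j assume ij: "i \<in> {..<k}" "j \<in> {..<k}"
    show "\<forall>\<^sub>F t in at_right 0. i < j \<longrightarrow> ?u t j < ?u t i"
    proof (cases "i < j")
      case True
      then have "y j < y i" using y(1) ij by (simp add: monotone_on_def)
      \<comment> \<open>The midpoint separates the two limits, so each curve only has to be compared
        with a constant.\<close>
      then have "y j < (y i + y j) / 2" "(y i + y j) / 2 < y i" by simp_all
      then have "\<forall>\<^sub>F t in at_right 0. ?u t j < (y i + y j) / 2"
        "\<forall>\<^sub>F t in at_right 0. (y i + y j) / 2 < ?u t i"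
        using ij order_tendstoD[OF lim] by blast+
      then show ?thesis by eventually_elim simp
    qed simp
  qed
  then show ?thesis
    by (rule eventually_mono) (auto intro!: monotone_onI simp: le_less)
qed

theorem theorem2:
  fixes G :: "'a pair_pre_digraph"
    and x :: "'a \<Rightarrow> real"
    and A :: "'a set list"
    and y :: "nat \<Rightarrow> real"
  assumes "pair_fin_digraph G"
    and "strongly_connected (with_proj G)"
    and "\<And>v. v \<in> pverts G \<Longrightarrow> out_nbrs G v \<noteq> {}"
    and "x \<in> positive_on (pverts G)"
    and "ennreal (S_min G x) = m_min G"
    and "arrangement_of_type (pverts G) x A"
    and "\<And>v. v \<in> pverts G \<Longrightarrow> y (block_index A v) = x v"
  shows "is_arg_min (S_min_reduction G A) (\<lambda>z. z \<in> positive_on {..<length A}) y \<and>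
         S_min_reduction G A y = (INF z\<in>positive_on {..<length A}. S_min_reduction G A z)"
proof -
  let ?S = "S_min_reduction G A" and ?P = "positive_on {..<length A}"
  note G = assms(1) and out = assms(3) and yx = assms(7)
  have A: "preferential_arrangement (pverts G) A"
    using assms(6) by (simp add: arrangement_of_type_def)
  \<comment> \<open>The definition of \<open>strongly_connected\<close> includes a nonempty vertex
    set.\<close>
  have nonempty: "pverts G \<noteq> {}"
    using assms(2) by (simp add: strongly_connected_def)
  have y_pos: "y \<in> ?P"
  proof -
    have "0 < y j" if j: "j < length A" for j
      using assms(4) yx by (rule_tac ex_block_index[OF A j]) (force simp: positive_on_def)
    then show ?thesis by (simp add: positive_on_def)
  qed
  have y_dec: "strict_antimono_on {..<length A} y"
  proof (rule monotone_onI)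
    fix i j assume ij: "i \<in> {..<length A}" "j \<in> {..<length A}" "i < j"
    obtain v where v: "v \<in> pverts G" "v \<in> A ! i" "block_index A v = i"
      using ex_block_index[OF A] ij(1) by blast
    obtain w where w: "w \<in> pverts G" "w \<in> A ! j" "block_index A w = j"
      using ex_block_index[OF A] ij(2) by blast
    have "x w < x v"
      using assms(6) v(2) w(2) ij unfolding arrangement_of_type_def by blast
    then show "y j < y i" using yx v w by metis
  qed
  have S_y: "?S y = S_min G x"
  proof -
    have "?S y = S_min G (\<lambda>v. y (block_index A v))"
      using S_min_reduction_antimono[OF G out A] y_dec
      by (simp add: monotone_on_def le_less)
    \<comment> \<open>The two vectors agree on \<open>pverts G\<close>, which contains all
      out-neighbours, so the minima agree too.\<close>
    also have "\<dots> = S_min G x"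
      unfolding S_min_def min_out_def using yx out_nbrs_subset[OF G out]
      by (intro sum.cong arg_cong2[where f = divide] arg_cong[where f = Min] image_cong) auto
    finally show ?thesis .
  qed
  have minimal: "?S y \<le> ?S z" if z: "z \<in> ?P" for z
  proof -
    \<comment> \<open>The geometric segment from \<open>y\<close> to \<open>z\<close>. A small
      \<open>t\<close> in (0,1) keeps \<open>?u t\<close> ordered like the blocks, where the
      reduction is a value of \<open>S_min G\<close> and so bounded below by
      \<open>m_min G\<close>.\<close>
    let ?u = "\<lambda>t j. y j powr (1 - t) * z j powr t"
    have "\<forall>\<^sub>F t in at_right 0. antimono_on {..<length A} (?u t) \<and> t \<in> {0<..<1}"
      by (intro eventually_conj eventually_antimono_on_geometric_mean[OF y_dec y_pos z]
          eventually_at_right_real) simp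
    then obtain t :: real where t: "antimono_on {..<length A} (?u t)" "0 < t" "t < 1"
      using eventually_happens'[OF trivial_limit_at_right_real] by fastforce
    have u_pos: "?u t j > 0" if "j < length A" for j
      proof -
      have "0 < y j" "0 < z j" using y_pos z that by (simp_all add: positive_on_def)
      then show ?thesis by simp
    qed
    have "ennreal (S_min G x) \<le> ennreal (S_min G (\<lambda>v. ?u t (block_index A v)))"
      unfolding assms(5) using nonempty u_pos block_index_less[OF A]
      by (intro m_min_le_S_min[OF G out]) (auto simp: positive_on_def)
    also have "S_min G (\<lambda>v. ?u t (block_index A v)) = ?S (?u t)"
      by (simp only: S_min_reduction_antimono[OF G out A t(1)])
    finally have "ennreal (?S y) \<le> ennreal (?S (?u t))"
      by (simp only: S_y)
    \<comment> \<open>\<open>ennreal\<close> sends negative reals to 0, so the return to real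
      numbers needs a nonnegative right-hand side.\<close>
    moreover have "0 \<le> ?S (?u t)"
      unfolding S_min_reduction_def by (intro sum_nonneg divide_nonneg_nonneg) auto
    ultimately have "?S y \<le> ?S (?u t)"
      by (simp add: ennreal_le_iff)
    also have "\<dots> \<le> (1 - t) * ?S y + t * ?S z"
      using S_min_reduction_geometric_mean[OF G out A y_pos z, of t] t by simp
    \<comment> \<open>The share \<open>(1 - t) * ?S y\<close> cancels; \<open>t > 0\<close> then
      allows division by \<open>t\<close>.\<close>
    finally have "t * ?S y \<le> t * ?S z"
      by (simp add: algebra_simps)
    then show ?thesis using t by simp
  qed
  moreover have "(INF z\<in>?P. ?S z) = ?S y"
    using y_pos minimal by (intro cInf_eq_minimum) auto
  ultimately show ?thesis
    using y_pos by (auto simp: is_arg_min_def not_less)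
qed

end
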